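(* Let $(\mathfrak{X},d)$ be a compact metric space (nonempty). The maps $\delta,\sigma,\iota,\alpha:\ell^\infty(\mathfrak{X})\to\mathbb{R}$, $\delta(f)=\|f\|_\infty$, $\sigma(f)=\sup_{\mathfrak{X}}f$, $\iota(f)=\inf_{\mathfrak{X}}f$, $\alpha(f)=\sup_{\mathfrak{X}}f-\inf_{\mathfrak{X}}f$, are Hadamard directionally differentiable at every $f\in\ell^\infty(\mathfrak{X})\setminus\{0\}$, and their derivatives can be expressed, for $g\in\ell^\infty(\mathfrak{X})$, as $$\delta'_f(g)=\sup_{A_0(|f|)}\big(g\cdot\operatorname{sgn}(f)\big)^{\blacktriangle}_{|f|},\qquad \sigma'_f(g)=\sup_{A_0(f)}g^{\blacktriangle}_f,$$ $$\iota'_f(g)=\inf_{B_0(f)}g^{\blacktriangledown}_f,\qquad \alpha'_f(g)=\sup_{A_0(f)}g^{\blacktriangle}_f-\inf_{B_0(f)}g^{\blacktriangledown}_f,$$ where for $h,l\in\ell^\infty(\mathfrak{X})$, $$A_0(h)=\Big\{x\in\mathfrak{X}:\text{there exists }\{x_n\}\subset\mathfrak{X}\text{ with }x_n\to x\text{ and }h(x_n)\to\sup_{\mathfrak{X}}h\Big\},$$ $$B_0(h)=\Big\{x\in\mathfrak{X}:\text{there exists }\{x_n\}\subset\mathfrak{X}\text{ with }x_n\to x\text{ and }h(x_n)\to\inf_{\mathfrak{X}}h\Big\},$$ $$h^{\blacktriangle}_l(x)=\sup\Big\{\limsup_{n\to\infty}h(x_n):x_n\to x\text{ and }l(x_n)\to\sup_{\mathfrak{X}}l\Big\},\quad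 x\in A_0(l),$$ $$h^{\blacktriangledown}_l(x)=\inf\Big\{\liminf_{n\to\infty}h(x_n):x_n\to x\text{ and }l(x_n)\to\inf_{\mathfrak{X}}l\Big\},\quad x\in B_0(l).$$
   Context: $\ell^\infty(\mathfrak{X})$ is the real Banach space of bounded functions $f:\mathfrak{X}\to\mathbb{R}$ with norm $\|f\|_\infty=\sup_{x\in\mathfrak{X}}|f(x)|$; $\operatorname{sgn}$ is the sign function. Hadamard directional differentiability: let $\mathcal{D},\mathcal{E}$ be real Banach spaces. A map $\phi:\mathcal{D}\to\mathcal{E}$ is Hadamard directionally differentiable at $\theta\in\mathcal{D}$ tangentially to a set $\mathcal{D}_0\subset\mathcal{D}$ if there is a map $\phi'_\theta:\mathcal{D}_0\to\mathcal{E}$ (the derivative, not required to be linear) such that $\big\|\frac{\phi(\theta+t_nh_n)-\phi(\theta)}{t_n}-\phi'_\theta(h)\big\|_{\mathcal{E}}\to0$ for all $h\in\mathcal{D}_0$ and all sequences $\{t_n\}\subset\mathbb{R}$, $\{h_n\}\subset\mathcal{D}$ with $t_n\downarrow0$ and $\|h_n-h\|_{\mathcal{D}}\to0$. When no tangency set is mentioned, $\mathcal{D}_0=\mathcal{D}$. *)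

theory Defs
  imports "HOL-Analysis.Analysis"
begin

section \<open>The Banach space of bounded real functions\<close>

typedef 'a linf = "{f :: 'a \<Rightarrow> real. bounded (range f)}"
  morphisms apply_linf Abs_linf
  by (rule exI[of _ "\<lambda>_. 0"]) (auto simp: image_constant_conv)

setup_lifting type_definition_linf

lemma linf_eqI: "(\<And>x. apply_linf f x = apply_linf g x) \<Longrightarrow> f = g"
  by transfer auto

lemma bounded_apply_linf: "bounded (range (apply_linf f))"
  using apply_linf[of f] by simp

text \<open>The class constant \<^const>\<open>sgn\<close> on \<^typ>\<open>'a linf\<close> is the normalisation required by
  \<^class>\<open>real_normed_vector\<close>, not the pointwise sign function.\<close>

instantiation linf :: (type) real_normed_vector
begin

lift_definition zero_linf :: "'a linf" is "\<lambda>_. 0"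
  by (auto simp: image_constant_conv)

lift_definition plus_linf :: "'a linf \<Rightarrow> 'a linf \<Rightarrow> 'a linf" is "\<lambda>f g x. f x + g x"
  by (rule bounded_plus_comp)

lift_definition uminus_linf :: "'a linf \<Rightarrow> 'a linf" is "\<lambda>f x. - f x"
  by (simp add: bounded_iff)

lift_definition minus_linf :: "'a linf \<Rightarrow> 'a linf \<Rightarrow> 'a linf" is "\<lambda>f g x. f x - g x"
  by (rule bounded_minus_comp)

lift_definition scaleR_linf :: "real \<Rightarrow> 'a linf \<Rightarrow> 'a linf" is "\<lambda>c f x. c * f x"
  using bounded_scaleR_comp[where 'b=real] by simp

lift_definition norm_linf :: "'a linf \<Rightarrow> real" is "\<lambda>f. SUP x. \<bar>f x\<bar>" .

definition dist_linf :: "'a linf \<Rightarrow> 'a linf \<Rightarrow> real"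
  where "dist_linf f g = norm (f - g)"

definition sgn_linf :: "'a linf \<Rightarrow> 'a linf"
  where "sgn_linf f = inverse (norm f) *\<^sub>R f"

definition uniformity_linf :: "('a linf \<times> 'a linf) filter"
  where "uniformity_linf = (INF e\<in>{0<..}. principal {(f, g). dist f g < e})"

definition open_linf :: "'a linf set \<Rightarrow> bool"
  where "open_linf U \<longleftrightarrow> (\<forall>f\<in>U. \<forall>\<^sub>F (f', g) in uniformity. f' = f \<longrightarrow> g \<in> U)"

lemma bdd_above_abs_linf: "bdd_above (range (\<lambda>x. \<bar>apply_linf f x\<bar>))"
  using bounded_apply_linf[of f] by (auto simp: bounded_iff bdd_above_def)

lemma abs_le_norm_linf: "\<bar>apply_linf f x\<bar> \<le> norm f"
  unfolding norm_linf.rep_eq by (rule cSUP_upper[OF _ bdd_above_abs_linf]) simp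

lemma norm_linf_leI: "(\<And>x. \<bar>apply_linf f x\<bar> \<le> c) \<Longrightarrow> norm f \<le> c"
  unfolding norm_linf.rep_eq by (rule cSUP_least) auto

instance
proof
  fix f g h :: "'a linf" and a b :: real
  show "f + g + h = f + (g + h)" "f + g = g + f" "0 + f = f" "- f + f = 0" "f - g = f + - g"
    "a *\<^sub>R (f + g) = a *\<^sub>R f + a *\<^sub>R g" "(a + b) *\<^sub>R f = a *\<^sub>R f + b *\<^sub>R f"
    "a *\<^sub>R b *\<^sub>R f = (a * b) *\<^sub>R f" "1 *\<^sub>R f = f"
    by (transfer; simp add: algebra_simps)+
  show "dist f g = norm (f - g)" "sgn f = inverse (norm f) *\<^sub>R f"
    "uniformity = (INF e\<in>{0<..}. principal {(f, g :: 'a linf). dist f g < e})"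
    by (rule dist_linf_def sgn_linf_def uniformity_linf_def)+
  show "open U \<longleftrightarrow> (\<forall>f\<in>U. \<forall>\<^sub>F (f', g) in uniformity. f' = f \<longrightarrow> g \<in> U)" for U :: "'a linf set"
    by (rule open_linf_def)
  show "norm f = 0 \<longleftrightarrow> f = 0"
  proof
    assume "norm f = 0"
    then have "\<bar>apply_linf f x\<bar> \<le> 0" for x
      using abs_le_norm_linf[of f x] by simp
    then show "f = 0"
      by (intro linf_eqI) (simp add: zero_linf.rep_eq)
  qed (simp add: norm_linf.rep_eq zero_linf.rep_eq)
  show "norm (f + g) \<le> norm f + norm g"
  proof (rule norm_linf_leI)
    fix x
    show "\<bar>apply_linf (f + g) x\<bar> \<le> norm f + norm g"
      using abs_le_norm_linf[of f x] abs_le_norm_linf[of g x] by (simp add: plus_linf.rep_eq)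
  qed
  have scale: "norm (c *\<^sub>R k) \<le> \<bar>c\<bar> * norm k" for c and k :: "'a linf"
    by (rule norm_linf_leI)
      (simp add: scaleR_linf.rep_eq abs_mult abs_le_norm_linf mult_left_mono)
  show "norm (a *\<^sub>R f) = \<bar>a\<bar> * norm f"
  proof (cases "a = 0")
    case True
    then show ?thesis
      by (simp add: norm_linf.rep_eq scaleR_linf.rep_eq)
  next
    case False
    have "inverse a *\<^sub>R a *\<^sub>R f = f"
      using False by (intro linf_eqI) (simp add: scaleR_linf.rep_eq)
    then have "norm f \<le> inverse \<bar>a\<bar> * norm (a *\<^sub>R f)"
      using scale[of "inverse a" "a *\<^sub>R f"] by simp
    with False have "\<bar>a\<bar> * norm f \<le> norm (a *\<^sub>R f)"
      by (simp add: field_simps)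
    with scale[of a f] show ?thesis
      by simp
  qed
qed

end

instance linf :: (type) banach
proof
  fix X :: "nat \<Rightarrow> 'a linf"
  assume "Cauchy X"
  have pt: "\<bar>apply_linf (X m) x - apply_linf (X n) x\<bar> \<le> dist (X m) (X n)" for m n x
    using abs_le_norm_linf[of "X m - X n" x] by (simp add: dist_norm minus_linf.rep_eq)
  have "Cauchy (\<lambda>n. apply_linf (X n) x)" for x
    unfolding Cauchy_def
  proof (intro allI impI)
    fix e :: real
    assume "e > 0"
    with \<open>Cauchy X\<close> obtain M where "\<forall>m\<ge>M. \<forall>n\<ge>M. dist (X m) (X n) < e"
      unfolding Cauchy_def by blast
    then show "\<exists>M. \<forall>m\<ge>M. \<forall>n\<ge>M. dist (apply_linf (X m) x) (apply_linf (X n) x) < e"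
      using pt by (metis dist_real_def le_less_trans)
  qed
  then have "\<forall>x. \<exists>l. (\<lambda>n. apply_linf (X n) x) \<longlonglongrightarrow> l"
    using Cauchy_convergent convergent_def by blast
  then obtain F where F: "\<And>x. (\<lambda>n. apply_linf (X n) x) \<longlonglongrightarrow> F x"
    by metis
  have unif: "\<exists>M. \<forall>n\<ge>M. \<forall>x. \<bar>apply_linf (X n) x - F x\<bar> \<le> e" if "e > 0" for e
  proof -
    obtain M where M: "\<forall>m\<ge>M. \<forall>n\<ge>M. dist (X m) (X n) < e"
      using \<open>Cauchy X\<close> \<open>e > 0\<close> unfolding Cauchy_def by blast
    have "\<bar>apply_linf (X n) x - F x\<bar> \<le> e" if "n \<ge> M" for n x
    proof (rule tendsto_upperbound)
      show "(\<lambda>m. \<bar>apply_linf (X n) x - apply_linf (X m) x\<bar>)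
          \<longlonglongrightarrow> \<bar>apply_linf (X n) x - F x\<bar>"
        by (intro tendsto_intros F)
      show "\<forall>\<^sub>F m in sequentially. \<bar>apply_linf (X n) x - apply_linf (X m) x\<bar> \<le> e"
        unfolding eventually_sequentially
        using M pt that by (meson less_imp_le order_trans)
    qed simp
    then show ?thesis by blast
  qed
  obtain M where M: "\<And>x. \<bar>apply_linf (X M) x - F x\<bar> \<le> 1"
    using unif[of 1] by auto
  have "\<bar>F x\<bar> \<le> norm (X M) + 1" for x
    using M[of x] abs_le_norm_linf[of "X M" x] by linarith
  then have "bounded (range F)"
    by (auto simp: bounded_iff)
  then have app: "apply_linf (Abs_linf F) = F"
    by (simp add: Abs_linf_inverse)
  have "X \<longlonglongrightarrow> Abs_linf F"
  proof (rule metric_LIMSEQ_I)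
    fix e :: real
    assume "e > 0"
    then obtain N where N: "\<forall>n\<ge>N. \<forall>x. \<bar>apply_linf (X n) x - F x\<bar> \<le> e / 2"
      using unif[of "e / 2"] by auto
    have "dist (X n) (Abs_linf F) < e" if "n \<ge> N" for n
    proof -
      have "dist (X n) (Abs_linf F) \<le> e / 2"
        unfolding dist_norm
        by (rule norm_linf_leI) (use N that in \<open>simp add: minus_linf.rep_eq app\<close>)
      with \<open>e > 0\<close> show ?thesis
        by simp
    qed
    then show "\<exists>N. \<forall>n\<ge>N. dist (X n) (Abs_linf F) < e"
      by blast
  qed
  then show "convergent X"
    by (rule convergentI)
qed


section \<open>Hadamard directional differentiability\<close>

text \<open>The derivative is not required to be linear, and its values outside the tangency set \<open>D\<close>
  are irrelevant. The condition \<open>t\<^sub>n \<down> 0\<close> is read as \<open>t\<^sub>n > 0\<close> and \<open>t\<^sub>n \<rightarrow> 0\<close>; requiring the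
  sequence to be decreasing as well would give the same notion, by passing to subsequences.\<close>

definition has_hadamard_dir_derivative ::
  "('d::banach \<Rightarrow> 'e::banach) \<Rightarrow> ('d \<Rightarrow> 'e) \<Rightarrow> 'd \<Rightarrow> 'd set \<Rightarrow> bool"
  where "has_hadamard_dir_derivative \<phi> \<phi>' \<theta> D \<longleftrightarrow>
    (\<forall>h\<in>D. \<forall>t hs. (\<forall>n. t n > 0) \<longrightarrow> t \<longlonglongrightarrow> 0 \<longrightarrow> hs \<longlonglongrightarrow> h \<longrightarrow>
      (\<lambda>n. norm ((\<phi> (\<theta> + t n *\<^sub>R hs n) - \<phi> \<theta>) /\<^sub>R t n - \<phi>' h)) \<longlonglongrightarrow> 0)"

lemma has_hadamard_dir_derivative_unique:
  assumes "has_hadamard_dir_derivative \<phi> \<phi>' \<theta> D" "has_hadamard_dir_derivative \<phi> \<phi>'' \<theta> D" "h \<in> D"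
  shows "\<phi>' h = \<phi>'' h"
proof -
  define t where "t n = inverse (real (Suc n))" for n
  let ?q = "\<lambda>n. (\<phi> (\<theta> + t n *\<^sub>R h) - \<phi> \<theta>) /\<^sub>R t n"
  have t: "\<forall>n. t n > 0" "t \<longlonglongrightarrow> 0"
    using LIMSEQ_inverse_real_of_nat by (auto simp: t_def[abs_def])
  have "?q \<longlonglongrightarrow> \<psi> h" if "has_hadamard_dir_derivative \<phi> \<psi> \<theta> D" for \<psi>
  proof -
    have "(\<lambda>n. norm (?q n - \<psi> h)) \<longlonglongrightarrow> 0"
      using that \<open>h \<in> D\<close> t tendsto_const[of h sequentially]
      unfolding has_hadamard_dir_derivative_def by blast
    then show ?thesis
      by (simp add: tendsto_norm_zero_iff LIM_zero_iff)
  qed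
  from this[OF assms(1)] this[OF assms(2)] show ?thesis
    by (rule LIMSEQ_unique)
qed


section \<open>Almost-extremal points and envelopes\<close>

definition A0 :: "('a::metric_space \<Rightarrow> real) \<Rightarrow> 'a set"
  where "A0 h = {x. \<exists>xs. xs \<longlonglongrightarrow> x \<and> (\<lambda>n. h (xs n)) \<longlonglongrightarrow> (SUP y. h y)}"

definition B0 :: "('a::metric_space \<Rightarrow> real) \<Rightarrow> 'a set"
  where "B0 h = {x. \<exists>xs. xs \<longlonglongrightarrow> x \<and> (\<lambda>n. h (xs n)) \<longlonglongrightarrow> (INF y. h y)}"

text \<open>\<^const>\<open>limsup\<close> and \<^const>\<open>liminf\<close> need a complete lattice, so they are taken in
  \<^typ>\<open>ereal\<close>. For bounded \<open>h\<close> they are finite, and for \<open>x\<close> in \<^term>\<open>A0 l\<close> or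
  \<^term>\<open>B0 l\<close> the sets below are nonempty and bounded; see the lemmas that follow.\<close>

definition upper_env :: "('a::metric_space \<Rightarrow> real) \<Rightarrow> ('a \<Rightarrow> real) \<Rightarrow> 'a \<Rightarrow> real"
  where "upper_env l h x = Sup {real_of_ereal (limsup (\<lambda>n. ereal (h (xs n)))) | xs.
    xs \<longlonglongrightarrow> x \<and> (\<lambda>n. l (xs n)) \<longlonglongrightarrow> (SUP y. l y)}"

definition lower_env :: "('a::metric_space \<Rightarrow> real) \<Rightarrow> ('a \<Rightarrow> real) \<Rightarrow> 'a \<Rightarrow> real"
  where "lower_env l h x = Inf {real_of_ereal (liminf (\<lambda>n. ereal (h (xs n)))) | xs.
    xs \<longlonglongrightarrow> x \<and> (\<lambda>n. l (xs n)) \<longlonglongrightarrow> (INF y. l y)}"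

lemma
  fixes s :: "nat \<Rightarrow> real"
  assumes "\<And>n. \<bar>s n\<bar> \<le> c"
  shows ereal_real_limsup: "ereal (real_of_ereal (limsup (\<lambda>n. ereal (s n)))) = limsup (\<lambda>n. ereal (s n))"
    and ereal_real_liminf: "ereal (real_of_ereal (liminf (\<lambda>n. ereal (s n)))) = liminf (\<lambda>n. ereal (s n))"
    and abs_real_limsup_le: "\<bar>real_of_ereal (limsup (\<lambda>n. ereal (s n)))\<bar> \<le> c"
    and abs_real_liminf_le: "\<bar>real_of_ereal (liminf (\<lambda>n. ereal (s n)))\<bar> \<le> c"
proof -
  have b: "- c \<le> s n" "s n \<le> c" for n
    using assms[of n] by linarith+
  have u: "limsup (\<lambda>n. ereal (s n)) \<le> ereal c"
    by (rule Limsup_bounded) (simp add: b)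
  have l: "ereal (- c) \<le> liminf (\<lambda>n. ereal (s n))"
    by (rule Liminf_bounded) (simp add: b del: uminus_ereal.simps)
  have m: "liminf (\<lambda>n. ereal (s n)) \<le> limsup (\<lambda>n. ereal (s n))"
    by (rule Liminf_le_Limsup) simp
  obtain p where p: "limsup (\<lambda>n. ereal (s n)) = ereal p"
    using u l m by (cases "limsup (\<lambda>n. ereal (s n))") auto
  obtain q where q: "liminf (\<lambda>n. ereal (s n)) = ereal q"
    using u l m by (cases "liminf (\<lambda>n. ereal (s n))") auto
  show "ereal (real_of_ereal (limsup (\<lambda>n. ereal (s n)))) = limsup (\<lambda>n. ereal (s n))"
    "ereal (real_of_ereal (liminf (\<lambda>n. ereal (s n)))) = liminf (\<lambda>n. ereal (s n))"
    "\<bar>real_of_ereal (limsup (\<lambda>n. ereal (s n)))\<bar> \<le> c"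
    "\<bar>real_of_ereal (liminf (\<lambda>n. ereal (s n)))\<bar> \<le> c"
    using u l m by (auto simp: p q)
qed

lemma A0_nonempty:
  fixes l :: "'a::metric_space \<Rightarrow> real"
  assumes "compact (UNIV :: 'a set)" "bounded (range l)"
  shows "A0 l \<noteq> {}"
proof -
  have "(SUP y. l y) \<in> closure (range l)"
    by (rule closure_contains_Sup) (use assms bounded_imp_bdd_above in auto)
  then obtain v where v: "\<And>n. v n \<in> range l" "v \<longlonglongrightarrow> (SUP y. l y)"
    unfolding closure_sequential by blast
  then have "\<forall>n. \<exists>x. v n = l x"
    by blast
  then obtain xs where xs: "\<And>n. v n = l (xs n)"
    by metis
  obtain x r where r: "strict_mono r" "(xs \<circ> r) \<longlonglongrightarrow> x"
    using assms(1) unfolding compact_def by (metis UNIV_I)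
  have "(\<lambda>n. l ((xs \<circ> r) n)) \<longlonglongrightarrow> (SUP y. l y)"
    using LIMSEQ_subseq_LIMSEQ[OF v(2) r(1)] xs by (simp add: o_def)
  with r(2) show ?thesis
    unfolding A0_def by blast
qed

lemma B0_eq_A0: "B0 l = A0 (\<lambda>x. - l x)"
proof -
  have "(INF y. l y) = - (SUP y. - l y)"
    by (simp add: Inf_real_def image_image)
  then have "(\<lambda>n. l (xs n)) \<longlonglongrightarrow> (INF y. l y) \<longleftrightarrow> (\<lambda>n. - l (xs n)) \<longlonglongrightarrow> (SUP y. - l y)" for xs
    using tendsto_minus_cancel_left[of "\<lambda>n. l (xs n)" "SUP y. - l y" sequentially] by simp
  then show ?thesis
    by (simp add: A0_def B0_def)
qed

lemma B0_nonempty: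
  fixes l :: "'a::metric_space \<Rightarrow> real"
  assumes "compact (UNIV :: 'a set)" "bounded (range l)"
  shows "B0 l \<noteq> {}"
  unfolding B0_eq_A0 using assms by (intro A0_nonempty) (simp_all add: bounded_iff)

lemma upper_env_set:
  assumes "\<And>y. \<bar>h y\<bar> \<le> c" "x \<in> A0 l"
  defines "S \<equiv> {real_of_ereal (limsup (\<lambda>n. ereal (h (xs n)))) | xs.
    xs \<longlonglongrightarrow> x \<and> (\<lambda>n. l (xs n)) \<longlonglongrightarrow> (SUP y. l y)}"
  shows "S \<noteq> {}" "S \<subseteq> {-c..c}"
proof -
  show "S \<noteq> {}"
    using assms(2) unfolding S_def A0_def by blast
  have "real_of_ereal (limsup (\<lambda>n. ereal (h (xs n)))) \<in> {-c..c}" for xs :: "nat \<Rightarrow> 'a"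
    unfolding atLeastAtMost_iff using abs_real_limsup_le[of "\<lambda>n. h (xs n)" c, OF assms(1)] by linarith
  then show "S \<subseteq> {-c..c}"
    unfolding S_def by blast
qed

lemma lower_env_set:
  assumes "\<And>y. \<bar>h y\<bar> \<le> c" "x \<in> B0 l"
  defines "S \<equiv> {real_of_ereal (liminf (\<lambda>n. ereal (h (xs n)))) | xs.
    xs \<longlonglongrightarrow> x \<and> (\<lambda>n. l (xs n)) \<longlonglongrightarrow> (INF y. l y)}"
  shows "S \<noteq> {}" "S \<subseteq> {-c..c}"
proof -
  show "S \<noteq> {}"
    using assms(2) unfolding S_def B0_def by blast
  have "real_of_ereal (liminf (\<lambda>n. ereal (h (xs n)))) \<in> {-c..c}" for xs :: "nat \<Rightarrow> 'a"
    unfolding atLeastAtMost_iff using abs_real_liminf_le[of "\<lambda>n. h (xs n)" c, OF assms(1)] by linarith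
  then show "S \<subseteq> {-c..c}"
    unfolding S_def by blast
qed

lemma upper_env_bounds:
  assumes "\<And>y. \<bar>h y\<bar> \<le> c" "x \<in> A0 l"
  shows "upper_env l h x \<in> {-c..c}"
proof -
  let ?S = "{real_of_ereal (limsup (\<lambda>n. ereal (h (xs n)))) | xs.
    xs \<longlonglongrightarrow> x \<and> (\<lambda>n. l (xs n)) \<longlonglongrightarrow> (SUP y. l y)}"
  have S: "?S \<noteq> {}" "?S \<subseteq> {-c..c}"
    by (rule upper_env_set; fact)+
  have "bdd_above ?S"
    by (rule bdd_above_mono[OF _ S(2)]) simp
  with S(1) have "Sup ?S \<in> closure ?S"
    by (rule closure_contains_Sup)
  with closure_minimal[OF S(2)] show ?thesis
    unfolding upper_env_def by auto
qed

lemma lower_env_bounds: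
  assumes "\<And>y. \<bar>h y\<bar> \<le> c" "x \<in> B0 l"
  shows "lower_env l h x \<in> {-c..c}"
proof -
  let ?S = "{real_of_ereal (liminf (\<lambda>n. ereal (h (xs n)))) | xs.
    xs \<longlonglongrightarrow> x \<and> (\<lambda>n. l (xs n)) \<longlonglongrightarrow> (INF y. l y)}"
  have S: "?S \<noteq> {}" "?S \<subseteq> {-c..c}"
    by (rule lower_env_set; fact)+
  have "bdd_below ?S"
    by (rule bdd_below_mono[OF _ S(2)]) simp
  with S(1) have "Inf ?S \<in> closure ?S"
    by (rule closure_contains_Inf)
  with closure_minimal[OF S(2)] show ?thesis
    unfolding lower_env_def by auto
qed


section \<open>The functionals\<close>

definition linf_delta :: "'a linf \<Rightarrow> real"
  where "linf_delta f = norm f"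

definition linf_sigma :: "'a linf \<Rightarrow> real"
  where "linf_sigma f = (SUP x. apply_linf f x)"

definition linf_iota :: "'a linf \<Rightarrow> real"
  where "linf_iota f = (INF x. apply_linf f x)"

definition linf_alpha :: "'a linf \<Rightarrow> real"
  where "linf_alpha f = (SUP x. apply_linf f x) - (INF x. apply_linf f x)"

end

theory Submission
  imports Defs
begin

text \<open>The number \<open>V\<close>, the supremum of \<open>upper_env f h\<close> over \<open>A0 f\<close>, is characterised by
  compactness as the limit, as \<open>\<delta>\<close> decreases to \<open>0\<close>, of the supremum of \<open>h\<close> over the
  superlevel set where \<open>f\<close> exceeds \<open>sup f - \<delta>\<close>. A first-order perturbation \<open>f + t h\<close> of \<open>f\<close>
  nearly attains its supremum only on such superlevel sets, so the supremum moves by \<open>t V + o(t)\<close>.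
  Only the behaviour near the supremum matters, which is why \<open>\<bar>f + t h\<bar>\<close> may be
  replaced by \<open>\<bar>f\<bar> + t h sgn f\<close>: where \<open>\<bar>f\<bar>\<close> is close to its positive supremum,
  small perturbations do not change the sign.\<close>

section \<open>Upper envelopes and superlevel sets\<close>

lemma limsup_le_upper_env:
  assumes h: "\<And>y. \<bar>h y\<bar> \<le> c"
    and xs: "xs \<longlonglongrightarrow> x" "(\<lambda>n. l (xs n)) \<longlonglongrightarrow> (SUP y. l y)"
  shows "real_of_ereal (limsup (\<lambda>n. ereal (h (xs n)))) \<le> upper_env l h x"
proof -
  have "x \<in> A0 l"
    using xs unfolding A0_def by blast
  show ?thesis
    unfolding upper_env_def
  proof (rule cSup_upper)
    show "bdd_above {real_of_ereal (limsup (\<lambda>n. ereal (h (xs n)))) | xs.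
      xs \<longlonglongrightarrow> x \<and> (\<lambda>n. l (xs n)) \<longlonglongrightarrow> (SUP y. l y)}"
      by (rule bdd_above_mono[OF bdd_above_Icc upper_env_set(2)[OF h \<open>x \<in> A0 l\<close>]])
  qed (use xs in blast)
qed

text \<open>A real \<open>SUP\<close> is sure to dominate its terms only over a set bounded above;
  \<open>upper_env_bounds\<close> carries the bound \<open>c\<close> from \<open>h\<close> over to
  the envelope.\<close>

lemma upper_env_le_SUP:
  assumes "\<And>y. \<bar>h y\<bar> \<le> c" "x \<in> A0 l"
  shows "upper_env l h x \<le> (SUP x\<in>A0 l. upper_env l h x)"
proof (rule cSUP_upper[OF assms(2)])
  show "bdd_above (upper_env l h ` A0 l)"
    using upper_env_bounds[of h c, OF assms(1)] by (intro bdd_aboveI[of _ c]) auto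
qed

text \<open>Otherwise points violating the bound exist at every depth
  \<open>inverse (Suc n)\<close>. By compactness a subsequence converges, necessarily to a point of
  \<open>A0 l\<close>, and the limsup of \<open>h\<close> along it is at least
  \<open>?V + \<epsilon>\<close> although the envelope there is at most \<open>?V\<close>.\<close>

lemma superlevel_upper_bound:
  fixes l h :: "'a::metric_space \<Rightarrow> real"
  assumes cpt: "compact (UNIV :: 'a set)" and l: "bounded (range l)"
    and h: "\<And>y. \<bar>h y\<bar> \<le> c" and "\<epsilon> > 0"
  obtains \<delta> where "\<delta> > 0"
    "\<And>y. l y > (SUP y. l y) - \<delta> \<Longrightarrow> h y < (SUP x\<in>A0 l. upper_env l h x) + \<epsilon>"
proof (rule ccontr)
  let ?M = "SUP y. l y" and ?V = "SUP x\<in>A0 l. upper_env l h x"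
  assume neg: "\<not> thesis"
  have "\<exists>y. l y > ?M - inverse (real (Suc n)) \<and> h y \<ge> ?V + \<epsilon>" for n
    using that[of "inverse (real (Suc n))"] neg
    by (metis inverse_positive_iff_positive not_less of_nat_0_less_iff zero_less_Suc)
  then obtain ys where ys: "\<And>n. l (ys n) > ?M - inverse (real (Suc n))" "\<And>n. h (ys n) \<ge> ?V + \<epsilon>"
    by metis
  have "(\<lambda>n. l (ys n)) \<longlonglongrightarrow> ?M"
  proof (rule tendsto_sandwich)
    show "(\<lambda>n. ?M - inverse (real (Suc n))) \<longlonglongrightarrow> ?M"
      using tendsto_diff[OF tendsto_const LIMSEQ_inverse_real_of_nat, of ?M] by simp
    show "\<forall>\<^sub>F n in sequentially. ?M - inverse (real (Suc n)) \<le> l (ys n)"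
      using ys(1) by (simp add: less_imp_le)
    show "\<forall>\<^sub>F n in sequentially. l (ys n) \<le> ?M"
      using l by (intro always_eventually allI cSUP_upper bounded_imp_bdd_above) auto
  qed simp
  moreover obtain x r where r: "strict_mono r" "(ys \<circ> r) \<longlonglongrightarrow> x"
    using cpt unfolding compact_def by (metis UNIV_I)
  ultimately have lim: "(\<lambda>n. l ((ys \<circ> r) n)) \<longlonglongrightarrow> ?M"
    using LIMSEQ_subseq_LIMSEQ[OF _ r(1), of "\<lambda>n. l (ys n)"] by (simp add: o_def)
  have "ereal (?V + \<epsilon>) \<le> liminf (\<lambda>n. ereal (h ((ys \<circ> r) n)))"
    using ys(2) by (intro Liminf_bounded) simp
  also have "\<dots> \<le> limsup (\<lambda>n. ereal (h ((ys \<circ> r) n)))"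
    by (rule Liminf_le_Limsup) simp
  \<comment> \<open>Boundedness of \<open>h\<close> makes the limsup finite, so
    \<open>real_of_ereal\<close> does not replace an infinite value by its default 0.\<close>
  also have "\<dots> = ereal (real_of_ereal (limsup (\<lambda>n. ereal (h ((ys \<circ> r) n)))))"
    by (rule ereal_real_limsup[symmetric]) (rule h)
  finally have "?V + \<epsilon> \<le> real_of_ereal (limsup (\<lambda>n. ereal (h ((ys \<circ> r) n))))"
    by simp
  also have "\<dots> \<le> upper_env l h x"
    by (rule limsup_le_upper_env[OF h r(2) lim])
  also have "\<dots> \<le> ?V"
    using r(2) lim by (intro upper_env_le_SUP[OF h]) (auto simp: A0_def)
  finally show False
    using \<open>\<epsilon> > 0\<close> by simp
qed

text \<open>The two nested suprema in \<open>?V\<close> are unwound: first a point \<open>x\<close>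
  of \<open>A0 l\<close>, then a sequence tending to \<open>x\<close> whose limsup of
  \<open>h\<close> still exceeds \<open>?V - \<epsilon>\<close>. Along it \<open>h\<close> is large
  infinitely often and \<open>l\<close> is eventually near its supremum, so some index serves
  both.\<close>

lemma superlevel_nearly_attained:
  fixes l h :: "'a::metric_space \<Rightarrow> real"
  assumes cpt: "compact (UNIV :: 'a set)" and l: "bounded (range l)"
    and h: "\<And>y. \<bar>h y\<bar> \<le> c" and "\<epsilon> > 0" "\<delta> > 0"
  obtains y where "l y > (SUP y. l y) - \<delta>" "h y > (SUP x\<in>A0 l. upper_env l h x) - \<epsilon>"
proof -
  let ?M = "SUP y. l y" and ?V = "SUP x\<in>A0 l. upper_env l h x"
  obtain x where x: "x \<in> A0 l" "?V - \<epsilon> < upper_env l h x"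
  proof -
    have "upper_env l h ` A0 l \<noteq> {}" "?V - \<epsilon> < ?V"
      using A0_nonempty[OF cpt l] \<open>\<epsilon> > 0\<close> by simp_all
    from less_cSupD[OF this] show ?thesis
      using that by blast
  qed
  obtain xs where xs: "(\<lambda>n. l (xs n)) \<longlonglongrightarrow> ?M"
      "?V - \<epsilon> < real_of_ereal (limsup (\<lambda>n. ereal (h (xs n))))"
  proof -
    have "\<exists>v\<in>{real_of_ereal (limsup (\<lambda>n. ereal (h (xs n)))) | xs.
        xs \<longlonglongrightarrow> x \<and> (\<lambda>n. l (xs n)) \<longlonglongrightarrow> ?M}. ?V - \<epsilon> < v"
    proof (rule less_cSupD)
      show "{real_of_ereal (limsup (\<lambda>n. ereal (h (xs n)))) | xs.
          xs \<longlonglongrightarrow> x \<and> (\<lambda>n. l (xs n)) \<longlonglongrightarrow> ?M} \<noteq> {}"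
        by (rule upper_env_set(1)[OF h x(1)])
      show "?V - \<epsilon> < Sup {real_of_ereal (limsup (\<lambda>n. ereal (h (xs n)))) | xs.
          xs \<longlonglongrightarrow> x \<and> (\<lambda>n. l (xs n)) \<longlonglongrightarrow> ?M}"
        using x(2) by (simp only: upper_env_def[of l h x])
    qed
    then show ?thesis
      using that by (elim bexE CollectE exE conjE) simp
  qed
  have "\<exists>\<^sub>F n in sequentially. h (xs n) > ?V - \<epsilon>"
  proof (rule ccontr)
    assume "\<not> ?thesis"
    then have "\<forall>\<^sub>F n in sequentially. ereal (h (xs n)) \<le> ereal (?V - \<epsilon>)"
      by (simp add: not_frequently not_less)
    then have "limsup (\<lambda>n. ereal (h (xs n))) \<le> ereal (?V - \<epsilon>)"
      by (rule Limsup_bounded)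
    moreover have "ereal (real_of_ereal (limsup (\<lambda>n. ereal (h (xs n)))))
        = limsup (\<lambda>n. ereal (h (xs n)))"
      by (rule ereal_real_limsup) (rule h)
    ultimately show False
      using xs(2) by (metis ereal_less_eq(3) not_le)
  qed
  moreover have "\<forall>\<^sub>F n in sequentially. l (xs n) > ?M - \<delta>"
    using order_tendstoD(1)[OF xs(1), of "?M - \<delta>"] \<open>\<delta> > 0\<close> by simp
  ultimately have "\<exists>\<^sub>F n in sequentially. l (xs n) > ?M - \<delta> \<and> h (xs n) > ?V - \<epsilon>"
    by (simp add: frequently_eventually_conj)
  then show thesis
    using that by (auto dest: frequently_ex)
qed

section \<open>First-order expansion of a supremum\<close>

text \<open>Common core for the supremum and the norm. The expansion of \<open>F n\<close> is
  demanded only on the superlevel set of fixed depth \<open>d\<close>, which leaves room for the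
  nonsmoothness of the absolute value; elsewhere the one-sided bound \<open>upper\<close> suffices,
  since such points cannot make up their deficit once \<open>t n\<close> is small.\<close>

lemma SUP_perturbation_tendsto:
  fixes l h :: "'a::metric_space \<Rightarrow> real" and F :: "nat \<Rightarrow> 'a \<Rightarrow> real"
  assumes cpt: "compact (UNIV :: 'a set)" and l: "bounded (range l)"
    and h: "\<And>y. \<bar>h y\<bar> \<le> c"
    and t: "\<And>n. t n > 0" "t \<longlonglongrightarrow> 0"
    and upper: "\<And>n y. F n y \<le> l y + t n * C"
    and e: "e \<longlonglongrightarrow> 0" and "d > 0"
    and near: "\<forall>\<^sub>F n in sequentially. \<forall>y. l y > (SUP y. l y) - d \<longrightarrow>
      \<bar>F n y - l y - t n * h y\<bar> \<le> t n * e n"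
  shows "(\<lambda>n. ((SUP y. F n y) - (SUP y. l y)) / t n) \<longlonglongrightarrow> (SUP x\<in>A0 l. upper_env l h x)"
proof -
  let ?M = "SUP y. l y" and ?V = "SUP x\<in>A0 l. upper_env l h x"
  have lM: "l y \<le> ?M" for y
    using l by (intro cSUP_upper bounded_imp_bdd_above) auto
  have bdd: "bdd_above (range (F n))" for n
    using order_trans[OF upper add_right_mono[OF lM]]
    by (intro bdd_aboveI[of _ "?M + t n * C"]) auto
  show ?thesis
  proof (rule LIMSEQ_I)
    fix r :: real
    assume "r > 0"
    \<comment> \<open>The quotient will lie between \<open>?V - 3 * \<epsilon>\<close> and
      \<open>?V + 2 * \<epsilon>\<close>, hence strictly within \<open>r\<close> of
      \<open>?V\<close>.\<close>
    define \<epsilon> where "\<epsilon> = r / 4"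
    have "\<epsilon> > 0" using \<open>r > 0\<close> by (simp add: \<epsilon>_def)
    obtain \<delta>' where \<delta>': "\<delta>' > 0" "\<And>y. l y > ?M - \<delta>' \<Longrightarrow> h y < ?V + \<epsilon>"
      by (rule superlevel_upper_bound[OF cpt l h \<open>\<epsilon> > 0\<close>]) (rule that)
    define \<delta> where "\<delta> = min \<delta>' d"
    have \<delta>: "\<delta> > 0" "\<delta> \<le> d" "\<And>y. l y > ?M - \<delta> \<Longrightarrow> h y < ?V + \<epsilon>"
      using \<delta>' \<open>d > 0\<close> by (auto simp: \<delta>_def)
    \<comment> \<open>Where \<open>l y \<le> ?M - \<delta>\<close>, the bound \<open>upper\<close>
      gives \<open>F n y \<le> ?M - \<delta> + t n * C\<close>. This stays below
      \<open>?M + t n * ?V\<close> as soon as \<open>t n * (C - ?V) < \<delta>\<close>.\<close>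
    have "(\<lambda>n. t n * (C - ?V)) \<longlonglongrightarrow> 0"
      using tendsto_mult_left_zero[OF t(2)] .
    then have "\<forall>\<^sub>F n in sequentially. t n * (C - ?V) < \<delta>"
      using \<delta>(1) by (rule order_tendstoD)
    moreover have "\<forall>\<^sub>F n in sequentially. e n < \<epsilon>"
      using e \<open>\<epsilon> > 0\<close> by (rule order_tendstoD)
    ultimately have "\<forall>\<^sub>F n in sequentially. norm (((SUP y. F n y) - ?M) / t n - ?V) < r"
      using near
    proof eventually_elim
      case (elim n)
      have tn: "t n > 0" by (rule t)
      have te: "t n * e n \<le> t n * \<epsilon>"
        using elim(2) tn by simp
      have "F n y \<le> ?M + t n * (?V + 2 * \<epsilon>)" for y
      proof (cases "l y > ?M - \<delta>")
        case True
        then have "t n * h y \<le> t n * (?V + \<epsilon>)"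
          using \<delta>(3) tn by (simp add: less_imp_le)
        moreover have "\<bar>F n y - l y - t n * h y\<bar> \<le> t n * e n"
          using elim(3) True \<delta>(2) by force
        ultimately show ?thesis
          using te lM[of y] by (simp add: algebra_simps abs_le_iff)
      next
        case False
        moreover have "0 \<le> t n * \<epsilon>"
          using tn \<open>\<epsilon> > 0\<close> by simp
        ultimately show ?thesis
          using upper[of n y] elim(1) by (simp add: algebra_simps)
      qed
      then have le: "(SUP y. F n y) \<le> ?M + t n * (?V + 2 * \<epsilon>)"
        by (intro cSUP_least) auto
      \<comment> \<open>The depth shrinks with \<open>t n\<close>, so that the loss in
        \<open>l\<close> costs only \<open>\<epsilon>\<close> after division by \<open>t n\<close>;
        the minimum with \<open>d\<close> keeps \<open>y\<close> where the expansion is valid. The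
        loss in \<open>h\<close> and the error \<open>e n\<close> account for the other two
        \<open>\<epsilon>\<close>.\<close>
      obtain y where y: "l y > ?M - min d (t n * \<epsilon>)" "h y > ?V - \<epsilon>"
      proof (rule superlevel_nearly_attained[OF cpt l h \<open>\<epsilon> > 0\<close>])
        show "min d (t n * \<epsilon>) > 0"
          using \<open>d > 0\<close> tn \<open>\<epsilon> > 0\<close> by simp
      qed (rule that)
      have "\<bar>F n y - l y - t n * h y\<bar> \<le> t n * e n"
        using elim(3) y(1) by force
      moreover have "t n * (?V - \<epsilon>) \<le> t n * h y"
        using y(2) tn by simp
      ultimately have "?M + t n * (?V - 3 * \<epsilon>) \<le> F n y"
        using te y(1) unfolding abs_le_iff right_diff_distrib by linarith
      also have "\<dots> \<le> (SUP y. F n y)"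
        using bdd by (intro cSUP_upper) auto
      finally have "?V - 3 * \<epsilon> \<le> ((SUP y. F n y) - ?M) / t n"
        using tn by (simp add: field_simps)
      moreover have "((SUP y. F n y) - ?M) / t n \<le> ?V + 2 * \<epsilon>"
        using le tn by (simp add: field_simps)
      ultimately show ?case
        using \<open>r > 0\<close> unfolding real_norm_def \<epsilon>_def abs_less_iff by linarith
    qed
    then show "\<exists>no. \<forall>n\<ge>no. norm (((SUP y. F n y) - ?M) / t n - ?V) < r"
      by (simp add: eventually_sequentially)
  qed
qed

section \<open>Rules for real-valued Hadamard directional derivatives\<close>

lemma has_hadamard_dir_derivative_real_iff:
  fixes \<phi> :: "'d::banach \<Rightarrow> real"
  shows "has_hadamard_dir_derivative \<phi> \<phi>' \<theta> D \<longleftrightarrow>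
    (\<forall>h\<in>D. \<forall>t hs. (\<forall>n. t n > 0) \<longrightarrow> t \<longlonglongrightarrow> 0 \<longrightarrow> hs \<longlonglongrightarrow> h \<longrightarrow>
      (\<lambda>n. (\<phi> (\<theta> + t n *\<^sub>R hs n) - \<phi> \<theta>) / t n) \<longlonglongrightarrow> \<phi>' h)"
  unfolding has_hadamard_dir_derivative_def tendsto_norm_zero_iff LIM_zero_iff
  by (simp add: divide_inverse mult.commute)

lemma has_hadamard_dir_derivative_diff:
  fixes \<phi> \<psi> :: "'d::banach \<Rightarrow> real"
  assumes "has_hadamard_dir_derivative \<phi> \<phi>' \<theta> D" "has_hadamard_dir_derivative \<psi> \<psi>' \<theta> D"
  shows "has_hadamard_dir_derivative (\<lambda>x. \<phi> x - \<psi> x) (\<lambda>h. \<phi>' h - \<psi>' h) \<theta> D"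
  unfolding has_hadamard_dir_derivative_real_iff
proof (intro ballI allI impI)
  fix h t hs
  assume *: "h \<in> D" "\<forall>n. t n > 0" "t \<longlonglongrightarrow> (0::real)" "hs \<longlonglongrightarrow> h"
  then have "(\<lambda>n. (\<phi> (\<theta> + t n *\<^sub>R hs n) - \<phi> \<theta>) / t n) \<longlonglongrightarrow> \<phi>' h"
    "(\<lambda>n. (\<psi> (\<theta> + t n *\<^sub>R hs n) - \<psi> \<theta>) / t n) \<longlonglongrightarrow> \<psi>' h"
    using assms unfolding has_hadamard_dir_derivative_real_iff by blast+
  from tendsto_diff[OF this]
  show "(\<lambda>n. (\<phi> (\<theta> + t n *\<^sub>R hs n) - \<psi> (\<theta> + t n *\<^sub>R hs n) - (\<phi> \<theta> - \<psi> \<theta>)) / t n)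
      \<longlonglongrightarrow> \<phi>' h - \<psi>' h"
    by (simp add: diff_divide_distrib add_divide_distrib algebra_simps)
qed

text \<open>The directions \<open>- hs n\<close> converge to \<open>- h\<close>, and the quotients
  of \<open>\<phi>\<close> at \<open>- \<theta>\<close> along them are the negatives of those
  required. This transfers results on suprema to infima.\<close>

lemma has_hadamard_dir_derivative_reflect:
  fixes \<phi> :: "'d::banach \<Rightarrow> real"
  assumes "has_hadamard_dir_derivative \<phi> \<phi>' (- \<theta>) UNIV"
  shows "has_hadamard_dir_derivative (\<lambda>x. - \<phi> (- x)) (\<lambda>h. - \<phi>' (- h)) \<theta> UNIV"
  unfolding has_hadamard_dir_derivative_real_iff
proof (intro ballI allI impI)
  fix h :: 'd and t hs
  assume *: "\<forall>n. t n > 0" "t \<longlonglongrightarrow> (0::real)" "hs \<longlonglongrightarrow> h"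
  from *(3) have "(\<lambda>n. - hs n) \<longlonglongrightarrow> - h"
    by (rule tendsto_minus)
  with assms *(1,2) have "(\<lambda>n. (\<phi> (- \<theta> + t n *\<^sub>R (- hs n)) - \<phi> (- \<theta>)) / t n) \<longlonglongrightarrow> \<phi>' (- h)"
    unfolding has_hadamard_dir_derivative_real_iff by blast
  from tendsto_minus[OF this]
  show "(\<lambda>n. (- \<phi> (- (\<theta> + t n *\<^sub>R hs n)) - - \<phi> (- \<theta>)) / t n) \<longlonglongrightarrow> - \<phi>' (- h)"
    by (simp add: minus_divide_left)
qed

text \<open>Negation exchanges \<open>INF\<close> with \<open>SUP\<close> and liminf with limsup, so
  both envelopes range over the same sequences. On the reals \<open>Inf\<close> is by definition the
  negative of \<open>Sup\<close> of the negated set, and \<open>real_of_ereal\<close> commutes with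
  negation, so default values agree as well.\<close>

lemma lower_env_eq_upper_env: "lower_env l h x = - upper_env (\<lambda>y. - l y) (\<lambda>y. - h y) x"
proof -
  have M: "(SUP y. - l y) = - (INF y. l y)"
    by (simp add: Inf_real_def image_image)
  have lim: "real_of_ereal (limsup (\<lambda>n. ereal (- h (xs n))))
      = - real_of_ereal (liminf (\<lambda>n. ereal (h (xs n))))" for xs :: "nat \<Rightarrow> 'a"
    using ereal_Limsup_uminus[of sequentially "\<lambda>n. ereal (h (xs n))"] by simp
  show ?thesis
    unfolding lower_env_def upper_env_def Inf_real_def M lim tendsto_minus_cancel_left[symmetric]
    by (intro arg_cong[where f = "\<lambda>S. - Sup S"]) auto
qed

lemma convergent_norm_bound:
  assumes "hs \<longlonglongrightarrow> (h :: 'd::real_normed_vector)"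
  obtains C where "\<And>n. norm (hs n) \<le> C"
  using convergent_imp_Bseq[of hs] assms unfolding Bseq_def convergent_def by blast

section \<open>Derivatives of the four functionals\<close>

lemma linf_sigma_hadamard:
  fixes f :: "'a::metric_space linf"
  assumes cpt: "compact (UNIV :: 'a set)"
  shows "has_hadamard_dir_derivative linf_sigma
    (\<lambda>g. SUP x\<in>A0 (apply_linf f). upper_env (apply_linf f) (apply_linf g) x) f UNIV"
  unfolding has_hadamard_dir_derivative_real_iff linf_sigma_def
proof (intro ballI allI impI)
  fix g :: "'a linf" and t hs
  assume t: "\<forall>n. t n > 0" "t \<longlonglongrightarrow> (0::real)" and hs: "hs \<longlonglongrightarrow> g"
  obtain C where C: "\<And>n. norm (hs n) \<le> C"
    using convergent_norm_bound[OF hs] by blast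
  show "(\<lambda>n. ((SUP x. apply_linf (f + t n *\<^sub>R hs n) x) - (SUP x. apply_linf f x)) / t n)
      \<longlonglongrightarrow> (SUP x\<in>A0 (apply_linf f). upper_env (apply_linf f) (apply_linf g) x)"
  proof (rule SUP_perturbation_tendsto[OF cpt bounded_apply_linf abs_le_norm_linf, of t])
    show "apply_linf (f + t n *\<^sub>R hs n) y \<le> apply_linf f y + t n * C" for n y
      using abs_le_norm_linf[of "hs n" y] C[of n] t(1)
      by (simp add: plus_linf.rep_eq scaleR_linf.rep_eq)
    show "(\<lambda>n. norm (hs n - g)) \<longlonglongrightarrow> 0"
      using hs by (simp add: tendsto_norm_zero_iff LIM_zero_iff)
    have "\<bar>apply_linf (f + t n *\<^sub>R hs n) y - apply_linf f y - t n * apply_linf g y\<bar>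
        \<le> t n * norm (hs n - g)" for n y
    proof -
      have "\<bar>apply_linf (f + t n *\<^sub>R hs n) y - apply_linf f y - t n * apply_linf g y\<bar>
          = t n * \<bar>apply_linf (hs n - g) y\<bar>"
        using t(1) by (simp add: plus_linf.rep_eq scaleR_linf.rep_eq minus_linf.rep_eq
            abs_mult less_imp_le right_diff_distrib[symmetric])
      also have "\<dots> \<le> t n * norm (hs n - g)"
        using t(1) by (simp add: abs_le_norm_linf)
      finally show ?thesis .
    qed
    \<comment> \<open>The estimate holds at every point, so the depth 1 is an arbitrary
      choice.\<close>
    then show "\<forall>\<^sub>F n in sequentially. \<forall>y. apply_linf f y > (SUP y. apply_linf f y) - 1 \<longrightarrow>
        \<bar>apply_linf (f + t n *\<^sub>R hs n) y - apply_linf f y - t n * apply_linf g y\<bar>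
          \<le> t n * norm (hs n - g)"
      by simp
  qed (use t in auto)
qed

text \<open>Reduces to the supremum at \<open>- f\<close> through \<open>inf k = - sup (- k)\<close>
  and the reflection rule.\<close>

lemma linf_iota_hadamard:
  fixes f :: "'a::metric_space linf"
  assumes cpt: "compact (UNIV :: 'a set)"
  shows "has_hadamard_dir_derivative linf_iota
    (\<lambda>g. INF x\<in>B0 (apply_linf f). lower_env (apply_linf f) (apply_linf g) x) f UNIV"
proof -
  have app: "apply_linf (- k) = (\<lambda>y. - apply_linf k y)" for k :: "'a linf"
    by (simp add: uminus_linf.rep_eq)
  have "linf_iota k = - linf_sigma (- k)" for k :: "'a linf"
    by (simp add: linf_iota_def linf_sigma_def app Inf_real_def image_image)
  then have iota: "linf_iota = (\<lambda>k :: 'a linf. - linf_sigma (- k))" ..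
  have "(INF x\<in>B0 (apply_linf f). lower_env (apply_linf f) (apply_linf g) x)
      = - (SUP x\<in>A0 (apply_linf (- f)). upper_env (apply_linf (- f)) (apply_linf (- g)) x)" for g
    by (simp add: B0_eq_A0 lower_env_eq_upper_env app Inf_real_def image_image)
  then show ?thesis
    unfolding iota using has_hadamard_dir_derivative_reflect[OF linf_sigma_hadamard[OF cpt, of "- f"]]
    by simp
qed

text \<open>A summand \<open>b\<close> this small leaves the sign of \<open>a\<close> unchanged, so
  the absolute value acts linearly.\<close>

lemma abs_add_eq_abs_add_sgn:
  fixes a b :: real
  assumes "\<bar>b\<bar> < \<bar>a\<bar>"
  shows "\<bar>a + b\<bar> = \<bar>a\<bar> + b * sgn a"
  using assms by (cases "a > 0"; cases "a = 0") (auto simp: sgn_real_def)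

text \<open>The norm is the supremum of \<open>\<bar>f\<bar>\<close>, whose first-order change in
  direction \<open>g\<close> is \<open>g * sgn f\<close> wherever the perturbation is smaller than
  \<open>\<bar>f\<bar>\<close>.\<close>

lemma linf_delta_hadamard:
  fixes f :: "'a::metric_space linf"
  assumes cpt: "compact (UNIV :: 'a set)" and "f \<noteq> 0"
  shows "has_hadamard_dir_derivative linf_delta
    (\<lambda>g. SUP x\<in>A0 (\<lambda>y. \<bar>apply_linf f y\<bar>).
      upper_env (\<lambda>y. \<bar>apply_linf f y\<bar>) (\<lambda>y. apply_linf g y * sgn (apply_linf f y)) x) f UNIV"
  unfolding has_hadamard_dir_derivative_real_iff linf_delta_def
proof (intro ballI allI impI)
  fix g :: "'a linf" and t hs
  assume t: "\<forall>n. t n > 0" "t \<longlonglongrightarrow> (0::real)" and hs: "hs \<longlonglongrightarrow> g"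
  obtain C where C: "\<And>n. norm (hs n) \<le> C"
    using convergent_norm_bound[OF hs] by blast
  have app: "apply_linf (f + t n *\<^sub>R hs n) y = apply_linf f y + t n * apply_linf (hs n) y" for n y
    by (simp add: plus_linf.rep_eq scaleR_linf.rep_eq)
  have tC: "\<bar>t n * apply_linf (hs n) y\<bar> \<le> t n * C" for n y
    using abs_le_norm_linf[of "hs n" y] C[of n] t(1)
    by (simp add: abs_mult less_imp_le mult_left_mono)
  have "(\<lambda>n. ((SUP y. \<bar>apply_linf (f + t n *\<^sub>R hs n) y\<bar>) - (SUP y. \<bar>apply_linf f y\<bar>)) / t n)
      \<longlonglongrightarrow> (SUP x\<in>A0 (\<lambda>y. \<bar>apply_linf f y\<bar>).
        upper_env (\<lambda>y. \<bar>apply_linf f y\<bar>) (\<lambda>y. apply_linf g y * sgn (apply_linf f y)) x)"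
  proof (rule SUP_perturbation_tendsto[OF cpt])
    show "bounded (range (\<lambda>y. \<bar>apply_linf f y\<bar>))"
      using bounded_apply_linf[of f] by (simp add: bounded_iff)
    show "\<bar>apply_linf g y * sgn (apply_linf f y)\<bar> \<le> norm g" for y
      using abs_le_norm_linf[of g y] by (simp add: abs_mult sgn_real_def)
    show "\<bar>apply_linf (f + t n *\<^sub>R hs n) y\<bar> \<le> \<bar>apply_linf f y\<bar> + t n * C" for n y
      unfolding app using tC[of n y] by linarith
    show "(\<lambda>n. norm (hs n - g)) \<longlonglongrightarrow> 0"
      using hs by (simp add: tendsto_norm_zero_iff LIM_zero_iff)
    \<comment> \<open>At depth \<open>norm f / 2\<close> the values of \<open>\<bar>f\<bar>\<close>
      exceed \<open>norm f / 2\<close>, while the perturbation is at most \<open>t n * C\<close>,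
      eventually below that number; hence no sign changes there.\<close>
    show "norm f / 2 > 0"
      using \<open>f \<noteq> 0\<close> by simp
    have "(\<lambda>n. t n * C) \<longlonglongrightarrow> 0"
      using tendsto_mult_left_zero[OF t(2)] .
    then have "\<forall>\<^sub>F n in sequentially. t n * C < norm f / 2"
      using \<open>norm f / 2 > 0\<close> by (rule order_tendstoD)
    then show "\<forall>\<^sub>F n in sequentially. \<forall>y. \<bar>apply_linf f y\<bar> > (SUP y. \<bar>apply_linf f y\<bar>) - norm f / 2
        \<longrightarrow> \<bar>\<bar>apply_linf (f + t n *\<^sub>R hs n) y\<bar> - \<bar>apply_linf f y\<bar>
          - t n * (apply_linf g y * sgn (apply_linf f y))\<bar> \<le> t n * norm (hs n - g)"
    proof (eventually_elim, intro allI impI)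
      fix n y
      assume n: "t n * C < norm f / 2"
        and y: "\<bar>apply_linf f y\<bar> > (SUP y. \<bar>apply_linf f y\<bar>) - norm f / 2"
      have "\<bar>t n * apply_linf (hs n) y\<bar> < \<bar>apply_linf f y\<bar>"
        using n y tC[of n y] by (simp add: norm_linf.rep_eq[symmetric])
      from abs_add_eq_abs_add_sgn[OF this]
      have "\<bar>\<bar>apply_linf (f + t n *\<^sub>R hs n) y\<bar> - \<bar>apply_linf f y\<bar>
          - t n * (apply_linf g y * sgn (apply_linf f y))\<bar>
          = \<bar>t n * (apply_linf (hs n - g) y * sgn (apply_linf f y))\<bar>"
        by (simp add: app minus_linf.rep_eq algebra_simps)
      also have "\<dots> \<le> t n * \<bar>apply_linf (hs n - g) y\<bar>"
        using t(1) by (simp add: abs_mult sgn_real_def less_imp_le)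
      also have "\<dots> \<le> t n * norm (hs n - g)"
        using t(1) by (simp add: abs_le_norm_linf)
      finally show "\<bar>\<bar>apply_linf (f + t n *\<^sub>R hs n) y\<bar> - \<bar>apply_linf f y\<bar>
          - t n * (apply_linf g y * sgn (apply_linf f y))\<bar> \<le> t n * norm (hs n - g)" .
    qed
  qed (use t in auto)
  then show "(\<lambda>n. (norm (f + t n *\<^sub>R hs n) - norm f) / t n)
      \<longlonglongrightarrow> (SUP x\<in>A0 (\<lambda>y. \<bar>apply_linf f y\<bar>).
        upper_env (\<lambda>y. \<bar>apply_linf f y\<bar>) (\<lambda>y. apply_linf g y * sgn (apply_linf f y)) x)"
    by (simp only: norm_linf.rep_eq)
qed

theorem corollary2p2:
  fixes f :: "'a::metric_space linf"
  assumes "compact (UNIV :: 'a set)"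
    and "f \<noteq> 0"
  shows "has_hadamard_dir_derivative linf_delta
      (\<lambda>g. SUP x\<in>A0 (\<lambda>y. \<bar>apply_linf f y\<bar>).
        upper_env (\<lambda>y. \<bar>apply_linf f y\<bar>) (\<lambda>y. apply_linf g y * sgn (apply_linf f y)) x) f UNIV
    \<and> has_hadamard_dir_derivative linf_sigma
      (\<lambda>g. SUP x\<in>A0 (apply_linf f). upper_env (apply_linf f) (apply_linf g) x) f UNIV
    \<and> has_hadamard_dir_derivative linf_iota
      (\<lambda>g. INF x\<in>B0 (apply_linf f). lower_env (apply_linf f) (apply_linf g) x) f UNIV
    \<and> has_hadamard_dir_derivative linf_alpha
      (\<lambda>g. (SUP x\<in>A0 (apply_linf f). upper_env (apply_linf f) (apply_linf g) x)
        - (INF x\<in>B0 (apply_linf f). lower_env (apply_linf f) (apply_linf g) x)) f UNIV"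
proof -
  \<comment> \<open>The oscillation is the difference of the two preceding functionals, so the
    difference rule yields its derivative.\<close>
  have "linf_alpha = (\<lambda>k :: 'a linf. linf_sigma k - linf_iota k)"
    by (simp add: fun_eq_iff linf_alpha_def linf_sigma_def linf_iota_def)
  then show ?thesis
    using linf_delta_hadamard[OF assms] linf_sigma_hadamard[OF assms(1), of f]
      linf_iota_hadamard[OF assms(1), of f]
      has_hadamard_dir_derivative_diff[OF linf_sigma_hadamard linf_iota_hadamard, OF assms(1) assms(1), of f]
    by simp
qed

end
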